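(* Let $(H,d)$ be a Hadamard space, $(x_n)_{n\in\mathbb{N}}\subset H$ a sequence and $x\in H$. If $(x_n)$ converges weakly to $x$ (i.e. $x_n\overset{w}\to x$), then $(x_n)$ converges to $x$ sequentially in the weak topology $\tau_w$ (i.e. $x_n\overset{\tau_w}\to x$). Moreover, if $(H,d)$ is weakly proper, then $x_n\overset{\tau_w}\to x$ implies $x_n\overset{w}\to x$.
   Context: A Hadamard space is a complete $\mathrm{CAT}(0)$ space. For $x\in H$, $\Gamma_x(H)$ is the set of all constant speed geodesics $\gamma:[0,1]\to H$ (i.e. $d(\gamma(s),\gamma(t))=|s-t|\,d(\gamma(0),\gamma(1))$ for all $s,t\in[0,1]$) with $\gamma(0)=x$. For a geodesic $\gamma$, $P_\gamma$ denotes the metric projection onto (the image of) $\gamma$. Weak convergence: $x_n\overset{w}\to x$ means $P_\gamma x_n\to x$ in the metric $d$ for every $\gamma\in\Gamma_x(H)$ (no boundedness of $(x_n)$ is required). Elementary sets: for $x\in H$, $\gamma\in\Gamma_x(H)$, $\varepsilon>0$, $U_x(\varepsilon;\gamma):=\{y\in H: d(x,P_\gamma y)<\varepsilon\}$; also $U_x(\varepsilon;\gamma_1,\dots,\gamma_n):=\bigcap_{i=1}^n U_x(\varepsilon;\gamma_i)$. Weak topology $\tau_w$: a set $U\subset H$ is weakly open if for every $x\in U$ there exist $\varepsilon>0$ and finitely many $\gamma_1,\dots,\gamma_n\in\Gamma_x(H)$ with $U_x(\varepsilon;\gamma_1,\dots,\gamma_n)\subseteq U$. The weakly open sets (together with $\emptyset$)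 form the topology $\tau_w$ on $H$. $x_n\overset{\tau_w}\to x$ means that every $U\in\tau_w$ containing $x$ contains all but finitely many $x_n$. $H$ is weakly proper if for every $x\in H$, every $\gamma\in\Gamma_x(H)$ and every $\varepsilon>0$ there exists $V\in\tau_w$ with $x\in V\subseteq U_x(\varepsilon;\gamma)$. *)

theory Defs
  imports "HOL-Analysis.Analysis"
begin

context metric_space
begin

text \<open>Only the values of \<open>\<gamma>\<close> on \<open>{0..1}\<close> are relevant; constant geodesics are allowed.\<close>

definition geodesic :: "(real \<Rightarrow> 'a) \<Rightarrow> bool" where
  "geodesic \<gamma> \<longleftrightarrow> (\<forall>s\<in>{0..1}. \<forall>t\<in>{0..1}. dist (\<gamma> s) (\<gamma> t) = \<bar>s - t\<bar> * dist (\<gamma> 0) (\<gamma> 1))"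

definition geodesics_from :: "'a \<Rightarrow> (real \<Rightarrow> 'a) set" where
  "geodesics_from x = {\<gamma>. geodesic \<gamma> \<and> \<gamma> 0 = x}"

end

text \<open>
  The comparison axiom for geodesic triangles with comparison triangles in the Euclidean plane.
  Any two sides of a triangle share a vertex \<open>p\<close>; they are given as geodesics
  \<open>\<alpha>\<close> and \<open>\<beta>\<close> issuing from \<open>p\<close>. The third side enters only through its length, and
  it exists because the space is geodesic. The points \<open>p'\<close>, \<open>q'\<close>, \<open>r'\<close> span a comparison
  triangle. Since all pairs \<open>\<alpha>\<close>, \<open>\<beta>\<close> are considered, every choice of two sides is covered;
  for two points on the same side the comparison is an equality.
\<close>

class cat0_space = metric_space +
  assumes geodesic_exists: "\<exists>\<gamma>. geodesic \<gamma> \<and> \<gamma> 0 = x \<and> \<gamma> 1 = y"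
    and cat0_comparison:
      "\<lbrakk>geodesic \<alpha>; \<alpha> 0 = p; \<alpha> 1 = q; geodesic \<beta>; \<beta> 0 = p; \<beta> 1 = r;
        dist (p' :: real^2) q' = dist p q; dist p' r' = dist p r; dist q' r' = dist q r;
        s \<in> {0..1}; t \<in> {0..1}\<rbrakk>
       \<Longrightarrow> dist (\<alpha> s) (\<beta> t) \<le> dist ((1 - s) *\<^sub>R p' + s *\<^sub>R q') ((1 - t) *\<^sub>R p' + t *\<^sub>R r')"

class hadamard_space = complete_space + cat0_space

text \<open>
  In a Hadamard space the nearest point on a geodesic exists and is unique, so the definite
  description below denotes it.
\<close>

definition metric_proj :: "'a::metric_space set \<Rightarrow> 'a \<Rightarrow> 'a" where
  "metric_proj S y = (THE z. z \<in> S \<and> (\<forall>w\<in>S. dist y z \<le> dist y w))"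

definition geodesic_proj :: "(real \<Rightarrow> 'a::metric_space) \<Rightarrow> 'a \<Rightarrow> 'a" where
  "geodesic_proj \<gamma> = metric_proj (\<gamma> ` {0..1})"

definition weakly_converges :: "(nat \<Rightarrow> 'a::metric_space) \<Rightarrow> 'a \<Rightarrow> bool" where
  "weakly_converges X x \<longleftrightarrow> (\<forall>\<gamma>\<in>geodesics_from x. (\<lambda>n. geodesic_proj \<gamma> (X n)) \<longlonglongrightarrow> x)"

definition elementary_set :: "'a::metric_space \<Rightarrow> real \<Rightarrow> (real \<Rightarrow> 'a) \<Rightarrow> 'a set" where
  "elementary_set x \<epsilon> \<gamma> = {y. dist x (geodesic_proj \<gamma> y) < \<epsilon>}"

text \<open>
  The empty family of geodesics is harmless: its intersection is the whole space, as is the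
  elementary set of the constant geodesic at \<open>x\<close>.
\<close>

definition weakly_open :: "'a::metric_space set \<Rightarrow> bool" where
  "weakly_open U \<longleftrightarrow> (\<forall>x\<in>U. \<exists>\<epsilon>>0. \<exists>G. finite G \<and> G \<subseteq> geodesics_from x \<and>
     (\<Inter>\<gamma>\<in>G. elementary_set x \<epsilon> \<gamma>) \<subseteq> U)"

definition weak_topology :: "'a::metric_space topology" where
  "weak_topology = topology weakly_open"

lemma weakly_open_Int:
  assumes "weakly_open U" "weakly_open V"
  shows "weakly_open (U \<inter> V)"
  unfolding weakly_open_def
proof
  fix x assume x: "x \<in> U \<inter> V"
  have "\<exists>\<epsilon>>0. \<exists>G. finite G \<and> G \<subseteq> geodesics_from x \<and>
      (\<Inter>\<gamma>\<in>G. elementary_set x \<epsilon> \<gamma>) \<subseteq> U"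
    using assms(1) x by (simp add: weakly_open_def)
  then obtain e F where F: "e > 0" "finite F" "F \<subseteq> geodesics_from x"
      "(\<Inter>\<gamma>\<in>F. elementary_set x e \<gamma>) \<subseteq> U"
    by (elim exE conjE) (rule that; assumption)
  have "\<exists>\<epsilon>>0. \<exists>G. finite G \<and> G \<subseteq> geodesics_from x \<and>
      (\<Inter>\<gamma>\<in>G. elementary_set x \<epsilon> \<gamma>) \<subseteq> V"
    using assms(2) x by (simp add: weakly_open_def)
  then obtain d G where G: "d > 0" "finite G" "G \<subseteq> geodesics_from x"
      "(\<Inter>\<gamma>\<in>G. elementary_set x d \<gamma>) \<subseteq> V"
    by (elim exE conjE) (rule that; assumption)
  have "(\<Inter>\<gamma>\<in>F \<union> G. elementary_set x (min e d) \<gamma>) \<subseteq>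
      (\<Inter>\<gamma>\<in>F. elementary_set x e \<gamma>) \<inter> (\<Inter>\<gamma>\<in>G. elementary_set x d \<gamma>)"
    by (simp add: elementary_set_def subset_iff)
  also have "\<dots> \<subseteq> U \<inter> V"
    using F(4) G(4) by (rule Int_mono)
  finally have "(\<Inter>\<gamma>\<in>F \<union> G. elementary_set x (min e d) \<gamma>) \<subseteq> U \<inter> V" .
  moreover have "min e d > 0" "finite (F \<union> G)" "F \<union> G \<subseteq> geodesics_from x"
    using F(1-3) G(1-3) by simp_all
  ultimately show "\<exists>\<epsilon>>0. \<exists>G. finite G \<and> G \<subseteq> geodesics_from x \<and>
      (\<Inter>\<gamma>\<in>G. elementary_set x \<epsilon> \<gamma>) \<subseteq> U \<inter> V"
    by (intro exI conjI)
qed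

lemma istopology_weakly_open: "istopology weakly_open"
  unfolding istopology_def
proof (intro conjI allI impI)
  fix \<K> :: "'a set set" assume \<K>: "\<forall>K\<in>\<K>. weakly_open K"
  show "weakly_open (\<Union>\<K>)"
    unfolding weakly_open_def
  proof
    fix x assume "x \<in> \<Union>\<K>"
    then obtain K where K: "K \<in> \<K>" "x \<in> K" by blast
    with \<K> have "weakly_open K" by blast
    then have "\<exists>\<epsilon>>0. \<exists>G. finite G \<and> G \<subseteq> geodesics_from x \<and>
        (\<Inter>\<gamma>\<in>G. elementary_set x \<epsilon> \<gamma>) \<subseteq> K"
      using K(2) by (simp add: weakly_open_def)
    moreover have "K \<subseteq> \<Union>\<K>" using K(1) by (rule Union_upper)
    ultimately show "\<exists>\<epsilon>>0. \<exists>G. finite G \<and> G \<subseteq> geodesics_from x \<and>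
        (\<Inter>\<gamma>\<in>G. elementary_set x \<epsilon> \<gamma>) \<subseteq> \<Union>\<K>"
      by (elim exE conjE) (intro exI conjI, assumption+, erule (1) subset_trans)
  qed
qed (rule weakly_open_Int)

lemma openin_weak_topology [simp]: "openin weak_topology U \<longleftrightarrow> weakly_open U"
  by (simp add: weak_topology_def istopology_weakly_open)

lemma topspace_weak_topology [simp]: "topspace weak_topology = UNIV"
proof -
  have "weakly_open UNIV"
    by (auto simp: weakly_open_def intro!: exI[of _ 1] exI[of _ "{}"])
  then show ?thesis
    using openin_subset[of weak_topology UNIV] by auto
qed

definition weakly_proper :: "'a::metric_space itself \<Rightarrow> bool" where
  "weakly_proper _ \<longleftrightarrow> (\<forall>x::'a. \<forall>\<gamma>\<in>geodesics_from x. \<forall>\<epsilon>>0.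
     \<exists>V. openin weak_topology V \<and> x \<in> V \<and> V \<subseteq> elementary_set x \<epsilon> \<gamma>)"

end

theory Submission
  imports Defs
begin

text \<open>
  Weak convergence to \<open>x\<close> says exactly that every elementary set at \<open>x\<close> contains almost all
  terms of the sequence, because the distance of \<open>x\<close> from the projections of the terms is what
  an elementary set bounds. Each weakly open set around \<open>x\<close> contains a finite intersection of
  elementary sets at \<open>x\<close>, and finitely many eventual memberships hold simultaneously; this gives
  the first implication. The converse holds once each elementary set is a weak neighbourhood of
  its base point. The definition of weak openness does not provide this, because it asks for
  elementary sets around every point of an open set; weak properness is precisely this
  condition.
\<close>

lemma weakly_converges_iff_eventually_elementary_set:
  "weakly_converges X x \<longleftrightarrow>
    (\<forall>\<gamma>\<in>geodesics_from x. \<forall>\<epsilon>>0. \<forall>\<^sub>F n in sequentially. X n \<in> elementary_set x \<epsilon> \<gamma>)"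
  by (simp add: weakly_converges_def elementary_set_def tendsto_iff dist_commute)

lemma weakly_converges_imp_limitin:
  assumes "weakly_converges X x"
  shows "limitin weak_topology X x sequentially"
  unfolding limitin_def
proof (intro conjI allI impI)
  fix U assume "openin weak_topology U \<and> x \<in> U"
  then obtain \<epsilon> G where "\<epsilon> > 0" "finite G" "G \<subseteq> geodesics_from x"
    and U: "(\<Inter>\<gamma>\<in>G. elementary_set x \<epsilon> \<gamma>) \<subseteq> U"
    unfolding openin_weak_topology weakly_open_def by metis
  then have "\<forall>\<^sub>F n in sequentially. \<forall>\<gamma>\<in>G. X n \<in> elementary_set x \<epsilon> \<gamma>"
    using assms
    by (auto simp: weakly_converges_iff_eventually_elementary_set intro!: eventually_ball_finite)
  then show "\<forall>\<^sub>F n in sequentially. X n \<in> U"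
    by (rule eventually_mono) (use U in blast)
qed simp

lemma limitin_imp_weakly_converges:
  fixes X :: "nat \<Rightarrow> 'a::metric_space"
  assumes "weakly_proper TYPE('a)" and lim: "limitin weak_topology X x sequentially"
  shows "weakly_converges X x"
  unfolding weakly_converges_iff_eventually_elementary_set
proof (intro ballI allI impI)
  fix \<gamma> and \<epsilon> :: real assume "\<gamma> \<in> geodesics_from x" "\<epsilon> > 0"
  with assms(1) obtain V where V: "openin weak_topology V" "x \<in> V" "V \<subseteq> elementary_set x \<epsilon> \<gamma>"
    unfolding weakly_proper_def by metis
  then have "\<forall>\<^sub>F n in sequentially. X n \<in> V"
    using lim unfolding limitin_def by blast
  then show "\<forall>\<^sub>F n in sequentially. X n \<in> elementary_set x \<epsilon> \<gamma>"
    by (rule eventually_mono) (use V(3) in blast)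
qed

theorem theorem1:
  fixes X :: "nat \<Rightarrow> 'a::hadamard_space" and x :: 'a
  shows "(weakly_converges X x \<longrightarrow> limitin weak_topology X x sequentially) \<and>
    (weakly_proper TYPE('a) \<longrightarrow>
      limitin weak_topology X x sequentially \<longrightarrow> weakly_converges X x)"
  using weakly_converges_imp_limitin limitin_imp_weakly_converges by blast

end
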